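(* Let $q\in[0,1]$ and let $(T_n)_{n\ge 1}$ be the BCMRT$(q)$ process. For integers $k\ge 1$ and $n\ge1$, let $N_k(n)$ be the number of nodes of degree $k$ in $T_n$ (which has $2n$ nodes). Then, for every integer $k\geq 1$, $$\frac{N_k(n)}{2n}\longrightarrow\frac{1}{2^k}\quad\text{in probability as } n\to+\infty .$$
   Context: BCMRT$(q)$ (balanced community modulated random recursive tree), $q\in[0,1]$: $T_1$ is a single edge (the root edge) joining two nodes with time-label $1$, one of type $A$, denoted $(1,A)$, and one of type $B$, denoted $(1,B)$. At each step $n\ge 2$, two new nodes with time-label $n$, namely $(n,A)$ of type $A$ and $(n,B)$ of type $B$, are added to the tree $T_{n-1}$ of size $2(n-1)$: (1) the two nodes independently (of each other and of the past) decide to connect to a node of their own type with probability $1-q$, or to a node of the other type with probability $q$; (2) each then independently chooses its parent uniformly among the $n-1$ nodes of $T_{n-1}$ of the selected type and is joined to it by an edge. This yields the tree $T_n$ of size $2n$. *)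

theory Defs
  imports "HOL-Probability.Probability"
begin

text \<open>Undirected graphs: an edge is the two-element set of its end points.\<close>

record 'v ugraph =
  verts :: "'v set"
  edges :: "'v set set"

definition vertex_degree :: "'v ugraph \<Rightarrow> 'v \<Rightarrow> nat" where
  "vertex_degree G v = card {e \<in> edges G. v \<in> e}"

definition num_degree :: "'v ugraph \<Rightarrow> nat \<Rightarrow> nat" where
  "num_degree G k = card {v \<in> verts G. vertex_degree G v = k}"

datatype community = TypeA | TypeB

fun other :: "community \<Rightarrow> community" where
  "other TypeA = TypeB"
| "other TypeB = TypeA"

type_synonym node = "nat \<times> community"

definition root_tree :: "node ugraph" where
  "root_tree = \<lparr>verts = {(1, TypeA), (1, TypeB)}, edges = {{(1, TypeA), (1, TypeB)}}\<rparr>"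

text \<open>
  The parent of a new node of type \<open>c\<close>: with probability \<open>q\<close> the selected type is the other one;
  the parent is then uniform among the nodes of \<open>G\<close> of the selected type.
\<close>

definition parent_pmf :: "real \<Rightarrow> node ugraph \<Rightarrow> community \<Rightarrow> node pmf" where
  "parent_pmf q G c = do {
     switch \<leftarrow> bernoulli_pmf q;
     pmf_of_set {v \<in> verts G. snd v = (if switch then other c else c)}
   }"

definition step_pmf :: "real \<Rightarrow> nat \<Rightarrow> node ugraph \<Rightarrow> node ugraph pmf" where
  "step_pmf q n G = do {
     a \<leftarrow> parent_pmf q G TypeA;
     b \<leftarrow> parent_pmf q G TypeB;
     return_pmf \<lparr>verts = verts G \<union> {(n, TypeA), (n, TypeB)},
                 edges = edges G \<union> {{(n, TypeA), a}, {(n, TypeB), b}}\<rparr>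
   }"

text \<open>
  A realisation of the process on an arbitrary probability space. The assumption
  \<open>transition\<close> says that, conditionally on \<open>T 1, \<dots>, T n\<close>, the tree \<open>T (n + 1)\<close>
  has law \<open>step_pmf q (n + 1) (T n)\<close>; it is written in product form so that histories of
  probability zero need no special treatment. The value \<open>T 0\<close> plays no role.
\<close>

locale BCMRT = prob_space M for M :: "'w measure" +
  fixes q :: real and T :: "nat \<Rightarrow> 'w \<Rightarrow> node ugraph"
  assumes measurable_T: "\<And>n. n \<ge> 1 \<Longrightarrow> random_variable (count_space UNIV) (T n)"
    and initial: "AE \<omega> in M. T 1 \<omega> = root_tree"
    and transition: "\<And>n h. n \<ge> 1 \<Longrightarrow>
      prob {\<omega> \<in> space M. \<forall>i\<in>{1..n + 1}. T i \<omega> = h i} =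
      prob {\<omega> \<in> space M. \<forall>i\<in>{1..n}. T i \<omega> = h i} * pmf (step_pmf q (n + 1) (h n)) (h (n + 1))"

definition tendsto_in_probability ::
    "'w measure \<Rightarrow> (nat \<Rightarrow> 'w \<Rightarrow> real) \<Rightarrow> ('w \<Rightarrow> real) \<Rightarrow> bool" where
  "tendsto_in_probability M X Y \<longleftrightarrow>
     (\<forall>\<epsilon>>0. (\<lambda>n. measure M {\<omega> \<in> space M. \<bar>X n \<omega> - Y \<omega>\<bar> > \<epsilon>}) \<longlonglongrightarrow> 0)"

end

(* Second moment method. Averaged over the two new nodes, every node of T_n receives 1/n new edges,
   whatever its type: this is where q disappears. With N_0 = 0 and the centred counts
   X_0 = 0, X_k = N_k - 2n/2^k, the conditional drift of X_k is therefore (X_{k-1} - X_k)/n, up to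
   an error O(1/n) caused by the event, of probability at most 1/n, that both new nodes choose the
   same parent. Increments are bounded and |X_k| <= 2n, so
     E X_k(n+1)^2 <= (1 - 1/n) E X_k(n)^2 + E X_{k-1}(n)^2 / n + 57,
   and induction on k gives E X_k(n)^2 = O(n). *)
theory Submission
  imports Defs
begin

lemma UNIV_community: "(UNIV :: community set) = {TypeA, TypeB}"
  by (auto intro: community.exhaust)

instance community :: finite
  by standard (simp add: UNIV_community)

subsection \<open>Growing a tree by one generation\<close>

definition attach :: "nat \<Rightarrow> node ugraph \<Rightarrow> node \<Rightarrow> node \<Rightarrow> node ugraph" where
  "attach n G a b = \<lparr>verts = verts G \<union> {(n, TypeA), (n, TypeB)},
                     edges = edges G \<union> {{(n, TypeA), a}, {(n, TypeB), b}}\<rparr>"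

text \<open>The invariant carried along the process. That edges stay inside the vertex set keeps the
  two new edges distinct from all old ones; that every node lies on an edge makes
  \<open>num_degree G 0\<close> vanish.\<close>

definition well_formed :: "nat \<Rightarrow> node ugraph \<Rightarrow> bool" where
  "well_formed n G \<longleftrightarrow> verts G = {1..n} \<times> UNIV \<and> edges G \<subseteq> Pow (verts G) \<and>
     (\<forall>v\<in>verts G. \<exists>e\<in>edges G. v \<in> e)"

lemma well_formed_verts: "well_formed n G \<Longrightarrow> verts G = {1..n} \<times> UNIV"
  by (simp add: well_formed_def)

lemma well_formed_finite_verts: "well_formed n G \<Longrightarrow> finite (verts G)"
  by (simp add: well_formed_verts)

lemma well_formed_finite_edges: "well_formed n G \<Longrightarrow> finite (edges G)"
  using well_formed_finite_verts[of n G] by (auto simp: well_formed_def intro: finite_subset)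

lemma well_formed_root_tree: "well_formed 1 root_tree"
  by (auto simp: well_formed_def root_tree_def UNIV_community)

lemma well_formed_attach:
  assumes "well_formed n G" "a \<in> verts G" "b \<in> verts G"
  shows "well_formed (Suc n) (attach (Suc n) G a b)"
proof -
  have "{1..Suc n} \<times> (UNIV :: community set) = {1..n} \<times> UNIV \<union> {(Suc n, TypeA), (Suc n, TypeB)}"
    by (auto simp: atLeastAtMostSuc_conv UNIV_community intro: community.exhaust)
  then show ?thesis
    using assms unfolding well_formed_def attach_def by auto
qed

text \<open>Edges form a set, so the point is that nothing is merged: each new edge contains its own
  new node, while both parents are old. A node chosen twice thus really gains two.\<close>

lemma vertex_degree_attach_old:
  assumes "well_formed n G" "a \<in> verts G" "b \<in> verts G" "v \<in> verts G"
  shows "vertex_degree (attach (Suc n) G a b) v =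
    vertex_degree G v + of_bool (a = v) + of_bool (b = v)"
proof -
  let ?A = "{(Suc n, TypeA), a}" and ?B = "{(Suc n, TypeB), b}"
  have new: "(Suc n, c) \<notin> verts G" for c
    using assms(1) by (simp add: well_formed_verts)
  have neq: "v \<noteq> (Suc n, c)" "a \<noteq> (Suc n, c)" "b \<noteq> (Suc n, c)" for c
    using new assms(2-4) by auto
  have "?A \<notin> edges G" "?B \<notin> edges G"
    using assms(1) new by (auto simp: well_formed_def)
  moreover have "?A \<noteq> ?B"
    using neq by (auto simp: doubleton_eq_iff)
  moreover have "{e \<in> edges (attach (Suc n) G a b). v \<in> e} =
      {e \<in> edges G. v \<in> e} \<union> ((if a = v then {?A} else {}) \<union> (if b = v then {?B} else {}))"
    using neq by (auto simp: attach_def)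
  ultimately show ?thesis
    using well_formed_finite_edges[OF assms(1)] unfolding vertex_degree_def
    by (subst \<open>{e \<in> edges (attach (Suc n) G a b). v \<in> e} = _\<close>, subst card_Un_disjoint)
       (auto split: if_splits)
qed

lemma vertex_degree_attach_new:
  assumes "well_formed n G" "a \<in> verts G" "b \<in> verts G"
  shows "vertex_degree (attach (Suc n) G a b) (Suc n, c) = 1"
proof -
  have new: "(Suc n, c) \<notin> verts G" for c
    using assms(1) by (simp add: well_formed_verts)
  then have neq: "a \<noteq> (Suc n, c)" "b \<noteq> (Suc n, c)" for c
    using assms(2,3) by auto
  have "(Suc n, c) \<notin> e" if "e \<in> edges G" for e
    using assms(1) new that unfolding well_formed_def by blast
  then have "{e \<in> edges (attach (Suc n) G a b). (Suc n, c) \<in> e} =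
      {e \<in> {{(Suc n, TypeA), a}, {(Suc n, TypeB), b}}. (Suc n, c) \<in> e}"
    unfolding attach_def ugraph.simps by blast
  also have "\<dots> = {if c = TypeA then {(Suc n, TypeA), a} else {(Suc n, TypeB), b}}"
    using neq[symmetric] by (cases c) auto
  finally have "{e \<in> edges (attach (Suc n) G a b). (Suc n, c) \<in> e} =
      {if c = TypeA then {(Suc n, TypeA), a} else {(Suc n, TypeB), b}}" .
  then show ?thesis
    by (simp add: vertex_degree_def)
qed

section \<open>Degree counts and their one-step increments\<close>

lemma num_degree_eq_sum:
  "finite (verts G) \<Longrightarrow> real (num_degree G k) = (\<Sum>v\<in>verts G. of_bool (vertex_degree G v = k))"
  by (simp only: num_degree_def sum_of_bool_eq Collect_conj_eq Collect_mem_eq)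

lemma num_degree_0:
  assumes "well_formed n G"
  shows "num_degree G 0 = 0"
proof -
  have "vertex_degree G v \<noteq> 0" if "v \<in> verts G" for v
  proof -
    have "{e \<in> edges G. v \<in> e} \<noteq> {}"
      using assms that unfolding well_formed_def by blast
    then show ?thesis
      using well_formed_finite_edges[OF assms] by (simp add: vertex_degree_def)
  qed
  then have "{v \<in> verts G. vertex_degree G v = 0} = {}"
    by blast
  then show ?thesis
    unfolding num_degree_def by (simp only: card.empty)
qed

lemma num_degree_le:
  assumes "well_formed n G"
  shows "num_degree G k \<le> 2 * n"
proof -
  have "num_degree G k \<le> card (verts G)"
    unfolding num_degree_def using well_formed_finite_verts[OF assms] by (intro card_mono) auto
  also have "\<dots> = 2 * n"
    by (simp add: well_formed_verts[OF assms] card_cartesian_product UNIV_community)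
  finally show ?thesis .
qed

definition gain :: "node ugraph \<Rightarrow> nat \<Rightarrow> node \<Rightarrow> real" where
  "gain G k v = of_bool (Suc (vertex_degree G v) = k) - of_bool (vertex_degree G v = k)"

text \<open>The correction needed because a node chosen by both new nodes jumps by two degrees.\<close>

definition coincidence :: "node ugraph \<Rightarrow> nat \<Rightarrow> node \<Rightarrow> node \<Rightarrow> real" where
  "coincidence G k a b = of_bool (a = b) * (of_bool (vertex_degree G a + 2 = k)
     - 2 * of_bool (Suc (vertex_degree G a) = k) + of_bool (vertex_degree G a = k))"

lemma num_degree_attach:
  assumes "well_formed n G" "a \<in> verts G" "b \<in> verts G"
  shows "real (num_degree (attach (Suc n) G a b) k) =
    real (num_degree G k) + 2 * of_bool (k = 1) + gain G k a + gain G k b + coincidence G k a b"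
proof -
  let ?G = "attach (Suc n) G a b"
  note fin = well_formed_finite_verts[OF assms(1)]
  have fin': "finite (verts ?G)"
    using fin by (simp add: attach_def)
  have new: "(Suc n, c) \<notin> verts G" for c
    using assms(1) by (simp add: well_formed_verts)
  have "real (num_degree ?G k) = (\<Sum>v\<in>verts G. of_bool (vertex_degree ?G v = k)) +
      (\<Sum>v\<in>{(Suc n, TypeA), (Suc n, TypeB)}. of_bool (vertex_degree ?G v = k))"
    unfolding num_degree_eq_sum[OF fin']
    by (subst sum.union_disjoint[symmetric]) (use fin new in \<open>auto simp: attach_def\<close>)
  also have "(\<Sum>v\<in>{(Suc n, TypeA), (Suc n, TypeB)}. of_bool (vertex_degree ?G v = k))
      = (2 * of_bool (k = 1) :: real)"
    using vertex_degree_attach_new[OF assms] by (auto simp: of_bool_def)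
  \<comment> \<open>At a common parent, the shift of the degree by two equals twice the first
    difference \<open>gain\<close> plus the second difference \<open>coincidence\<close>; elsewhere
    \<open>gain\<close> alone is exact.\<close>
  also have "(\<Sum>v\<in>verts G. of_bool (vertex_degree ?G v = k)) =
      (\<Sum>v\<in>verts G. of_bool (vertex_degree G v = k) + (if v = a then gain G k v else 0)
        + (if v = b then gain G k v else 0) + (if v = a then coincidence G k v b else 0))"
    using vertex_degree_attach_old[OF assms]
    by (intro sum.cong refl) (auto simp: gain_def coincidence_def)
  also have "\<dots> = real (num_degree G k) + gain G k a + gain G k b + coincidence G k a b"
    using assms fin by (simp add: sum.distrib num_degree_eq_sum)
  finally show ?thesis
    by simp
qed

lemma abs_gain_le: "\<bar>gain G k v\<bar> \<le> 1"
  by (simp add: gain_def)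

lemma abs_coincidence_le: "\<bar>coincidence G k a b\<bar> \<le> 2 * of_bool (a = b)"
  by (auto simp: coincidence_def)

text \<open>Class \<open>Suc k\<close> is fed by the nodes of degree \<open>k\<close> and drained by
  its own members; this couples each level of the recursion to the one below.\<close>

lemma sum_gain:
  assumes "finite (verts G)"
  shows "(\<Sum>v\<in>verts G. gain G (Suc k) v) = real (num_degree G k) - real (num_degree G (Suc k))"
  using assms by (simp add: gain_def sum_subtractf num_degree_eq_sum)

subsection \<open>The law of one step\<close>

lemma step_pmf_eq_map_pair:
  "step_pmf q n G = map_pmf (\<lambda>(a, b). attach n G a b)
     (pair_pmf (parent_pmf q G TypeA) (parent_pmf q G TypeB))"
  by (simp add: step_pmf_def attach_def pair_pmf_def map_pmf_def bind_assoc_pmf bind_return_pmf)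

lemma expectation_bind_pmf_finite:
  fixes h :: "'b \<Rightarrow> real"
  assumes "finite (set_pmf p)" "\<And>x. x \<in> set_pmf p \<Longrightarrow> finite (set_pmf (f x))"
  shows "measure_pmf.expectation (bind_pmf p f) h =
    measure_pmf.expectation p (\<lambda>x. measure_pmf.expectation (f x) h)"
  using assms by (subst pmf_expectation_bind[where A = "set_pmf p"])
    (auto simp: integral_measure_pmf[where A = "set_pmf p"])

context
  fixes q :: real and n :: nat and G :: "node ugraph"
  assumes q: "0 \<le> q" "q \<le> 1" and n: "n \<ge> 1" and G: "well_formed n G"
begin

lemma community_nodes: "{v \<in> verts G. snd v = c} = {1..n} \<times> {c}"
  using G by (auto simp: well_formed_verts)

lemma set_parent_pmf: "set_pmf (parent_pmf q G c) \<subseteq> verts G"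
proof -
  have "set_pmf (pmf_of_set {v \<in> verts G. snd v = c}) \<subseteq> verts G" for c
    using n G by (subst set_pmf_of_set) (auto simp: community_nodes well_formed_verts)
  then show ?thesis
    by (auto simp: parent_pmf_def set_bind_pmf)
qed

lemma finite_set_parent_pmf: "finite (set_pmf (parent_pmf q G c))"
  using set_parent_pmf well_formed_finite_verts[OF G] by (rule finite_subset)

text \<open>Both types have exactly \<open>n\<close> nodes, so the same denominator serves whether
  or not the type is switched.\<close>

lemma expectation_parent_pmf:
  fixes f :: "node \<Rightarrow> real"
  shows "measure_pmf.expectation (parent_pmf q G c) f =
    (q * (\<Sum>i=1..n. f (i, other c)) + (1 - q) * (\<Sum>i=1..n. f (i, c))) / real n"
proof -
  have ne: "{1..n} \<times> {c} \<noteq> {}" for c :: community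
    using n by auto
  have "sum f ({1..n} \<times> {c}) = (\<Sum>i=1..n. f (i, c))" for c
    using sum.cartesian_product[of "\<lambda>i c. f (i, c)" "{c}" "{1..n}"] by simp
  then have unif: "measure_pmf.expectation (pmf_of_set ({1..n} \<times> {c})) f = (\<Sum>i=1..n. f (i, c)) / real n" for c
    by (subst integral_pmf_of_set[OF ne]) (simp_all add: card_cartesian_product)
  have "measure_pmf.expectation (parent_pmf q G c) f =
      measure_pmf.expectation (bernoulli_pmf q)
        (\<lambda>s. measure_pmf.expectation (pmf_of_set ({1..n} \<times> {if s then other c else c})) f)"
    unfolding parent_pmf_def community_nodes
    by (rule expectation_bind_pmf_finite)
       (simp_all only: finite set_pmf_of_set[OF ne] finite_cartesian_product finite_atLeastAtMost)
  also have "\<dots> = (\<Sum>i=1..n. f (i, other c)) / real n * q + (\<Sum>i=1..n. f (i, c)) / real n * (1 - q)"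
    by (simp only: integral_bernoulli_pmf[OF q] unif if_True if_False)
  finally show ?thesis
    by (simp add: add_divide_distrib mult.commute)
qed

text \<open>A node is picked with probability \<open>(1 - q) / n\<close> by the newcomer of its own
  type and \<open>q / n\<close> by the other; the two weights add up to
  \<open>1 / n\<close>.\<close>

lemma expectation_parents_sum:
  fixes f :: "node \<Rightarrow> real"
  shows "measure_pmf.expectation (parent_pmf q G TypeA) f +
    measure_pmf.expectation (parent_pmf q G TypeB) f = (\<Sum>v\<in>verts G. f v) / real n"
proof -
  have "(\<Sum>v\<in>verts G. f v) = (\<Sum>i=1..n. f (i, TypeA)) + (\<Sum>i=1..n. f (i, TypeB))"
    unfolding well_formed_verts[OF G] UNIV_community
    using sum.cartesian_product[of "\<lambda>i c. f (i, c)" "{TypeA, TypeB}" "{1..n}"]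
    by (simp add: sum.distrib)
  then show ?thesis
    unfolding expectation_parent_pmf by (simp add: add_divide_distrib[symmetric] algebra_simps)
qed

lemma pmf_parent_pmf_le: "pmf (parent_pmf q G c) v \<le> 1 / real n"
proof -
  have le: "(\<Sum>i=1..n. indicator {v} (i, d) :: real) \<le> of_bool (snd v = d)" for d
  proof -
    have "(\<Sum>i=1..n. indicator {v} (i, d) :: real) = (\<Sum>i=1..n. if i = fst v then of_bool (snd v = d) else 0)"
      by (cases v, intro sum.cong) (auto simp: indicator_def)
    then show ?thesis by simp
  qed
  have "pmf (parent_pmf q G c) v = measure_pmf.expectation (parent_pmf q G c) (indicator {v})"
    by (simp add: measure_pmf_single)
  also have "\<dots> \<le> (q * of_bool (snd v = other c) + (1 - q) * of_bool (snd v = c)) / real n"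
    unfolding expectation_parent_pmf using q by (intro divide_right_mono add_mono mult_left_mono le) auto
  also have "\<dots> \<le> 1 / real n"
    using q by (intro divide_right_mono) (cases c; auto)+
  finally show ?thesis .
qed

text \<open>By independence this is the sum over \<open>v\<close> of the product of the two point
  masses; one factor is at most \<open>1 / n\<close> and the other sums to one.\<close>

lemma prob_same_parent_le:
  "measure_pmf.prob (pair_pmf (parent_pmf q G TypeA) (parent_pmf q G TypeB)) {(a, b). a = b}
    \<le> 1 / real n"
proof -
  let ?A = "parent_pmf q G TypeA" and ?B = "parent_pmf q G TypeB"
  let ?D = "(\<lambda>v. (v, v)) ` set_pmf ?A"
  \<comment> \<open>The full diagonal is infinite; its part over the support is finite, so its
    probability is a finite sum.\<close>
  have "measure_pmf.prob (pair_pmf ?A ?B) {(a, b). a = b} = measure_pmf.prob (pair_pmf ?A ?B) ?D"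
    by (intro measure_pmf.finite_measure_eq_AE) (auto simp: AE_measure_pmf_iff)
  also have "\<dots> = (\<Sum>v\<in>set_pmf ?A. pmf ?A v * pmf ?B v)"
    using finite_set_parent_pmf
    by (simp add: measure_measure_pmf_finite sum.reindex inj_on_def pmf_pair)
  also have "\<dots> \<le> (\<Sum>v\<in>set_pmf ?A. pmf ?A v * (1 / real n))"
    by (intro sum_mono mult_left_mono pmf_parent_pmf_le) auto
  also have "\<dots> = 1 / real n"
    using finite_set_parent_pmf by (simp add: sum_divide_distrib[symmetric] sum_pmf_eq_1)
  finally show ?thesis .
qed

lemma well_formed_step_pmf:
  assumes "H \<in> set_pmf (step_pmf q (Suc n) G)"
  shows "well_formed (Suc n) H"
  using assms set_parent_pmf by (auto simp: step_pmf_eq_map_pair intro!: well_formed_attach[OF G])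

lemma finite_set_step_pmf: "finite (set_pmf (step_pmf q m G))"
  by (simp add: step_pmf_eq_map_pair finite_set_parent_pmf)

end

subsection \<open>The second moment recursion\<close>

text \<open>The expected limit of \<open>num_degree / n\<close>. The exceptional value at 0 reflects
  the absence of isolated nodes and lets \<open>center_Suc\<close> start at
  \<open>k = 0\<close>.\<close>

definition center :: "nat \<Rightarrow> real" where
  "center k = (if k = 0 then 0 else 2 / 2 ^ k)"

definition deviation :: "nat \<Rightarrow> nat \<Rightarrow> node ugraph \<Rightarrow> real" where
  "deviation n k G = real (num_degree G k) - real n * center k"

lemma center_bounds: "0 \<le> center k" "center k \<le> 1"
  by (cases k; simp add: center_def)+

text \<open>The stationarity equation of the mean drift: two new leaves, plus inflow from level
  \<open>k\<close>, minus outflow from level \<open>Suc k\<close>, must equal the growth rate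
  \<open>center (Suc k)\<close>.\<close>

lemma center_Suc: "2 * of_bool (Suc k = 1) + center k = 2 * center (Suc k)"
  by (simp add: center_def)

lemma abs_deviation_le:
  assumes "well_formed n G"
  shows "\<bar>deviation n k G\<bar> \<le> 2 * real n"
proof -
  have "real (num_degree G k) \<le> 2 * real n"
    using num_degree_le[OF assms, of k] by linarith
  moreover have "real n * center k \<le> real n * 1" "0 \<le> real n * center k"
    using center_bounds[of k] by (intro mult_left_mono mult_nonneg_nonneg; simp)+
  ultimately show ?thesis
    by (simp add: deviation_def abs_le_iff)
qed

context
  fixes q :: real and n :: nat and G :: "node ugraph"
  assumes q: "0 \<le> q" "q \<le> 1" and n: "n \<ge> 1" and G: "well_formed n G"
begin

text \<open>Expand the square of \<open>X + D\<close>, where \<open>D\<close> is the one-step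
  increment of the deviation. Its mean pulls \<open>X\<close> towards \<open>Y\<close> at rate
  \<open>1 / n\<close>, and its square only adds a constant.\<close>

lemma expectation_step_deviation_sq:
  fixes k :: nat
  shows "measure_pmf.expectation (step_pmf q (Suc n) G) (\<lambda>H. (deviation (Suc n) (Suc k) H)\<^sup>2)
    \<le> (1 - 1 / real n) * (deviation n (Suc k) G)\<^sup>2 + (deviation n k G)\<^sup>2 / real n + 57"
proof -
  let ?A = "parent_pmf q G TypeA" and ?B = "parent_pmf q G TypeB"
  let ?P = "pair_pmf ?A ?B"
  let ?g = "gain G (Suc k)" and ?r = "coincidence G (Suc k)"
  define X where "X = deviation n (Suc k) G"
  define Y where "Y = deviation n k G"
  define d where "d = 2 * of_bool (Suc k = 1) - center (Suc k)"
  define D where "D = (\<lambda>(a, b). d + ?g a + ?g b + ?r a b)"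
  note finA = finite_set_parent_pmf[OF q n G]
  have finP: "finite (set_pmf ?P)"
    using finA by simp
  note int = integrable_measure_pmf_finite[OF finP]
  have dev: "deviation (Suc n) (Suc k) (attach (Suc n) G a b) = X + D (a, b)"
    if "(a, b) \<in> set_pmf ?P" for a b
  proof -
    have "a \<in> verts G" "b \<in> verts G"
      using that set_parent_pmf[OF q n G] by auto
    then show ?thesis
      by (simp add: deviation_def X_def D_def d_def num_degree_attach[OF G] algebra_simps del: One_nat_def)
  qed
  \<comment> \<open>The four terms of \<open>D\<close> are at most 2, 1, 1 and 2 in absolute value,
    so 7 is a safe bound.\<close>
  have D_sq: "(D p)\<^sup>2 \<le> 49" for p
  proof -
    obtain a b where p: "p = (a, b)" by (cases p)
    have "\<bar>d\<bar> \<le> 2"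
      using center_bounds[of "Suc k"] by (cases k) (simp_all add: d_def abs_le_iff)
    moreover have "\<bar>?r a b\<bar> \<le> 2"
      using abs_coincidence_le[of G "Suc k" a b] by (cases "a = b") auto
    ultimately have "\<bar>D p\<bar> \<le> 7"
      using abs_gain_le[of G "Suc k" a] abs_gain_le[of G "Suc k" b] by (simp add: D_def p)
    then have "(D p)\<^sup>2 \<le> 7\<^sup>2"
      by (metis abs_le_square_iff abs_numeral)
    then show ?thesis by simp
  qed
  define R where "R = measure_pmf.expectation ?P (\<lambda>(a, b). ?r a b)"
  have R: "\<bar>R\<bar> \<le> 2 / real n"
  proof -
    have "\<bar>R\<bar> \<le> measure_pmf.expectation ?P (\<lambda>p. \<bar>case p of (a, b) \<Rightarrow> ?r a b\<bar>)"
      unfolding R_def by (rule integral_abs_bound)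
    also have "\<dots> \<le> measure_pmf.expectation ?P (\<lambda>p. 2 * indicator {(a, b). a = b} p)"
    proof (intro integral_mono int)
      show "\<bar>case p of (a, b) \<Rightarrow> ?r a b\<bar> \<le> 2 * indicator {(a, b). a = b} p" for p
        using abs_coincidence_le[of G "Suc k" "fst p" "snd p"]
        by (simp add: case_prod_unfold indicator_def of_bool_def)
    qed
    also have "\<dots> = 2 * measure_pmf.prob ?P {(a, b). a = b}"
      by simp
    also have "\<dots> \<le> 2 * (1 / real n)"
      by (intro mult_left_mono prob_same_parent_le[OF q n G]) simp
    finally show ?thesis by simp
  qed
  have drift: "measure_pmf.expectation ?P D = (Y - X) / real n + R"
  proof -
    have "measure_pmf.expectation ?P D =
        measure_pmf.expectation ?P (\<lambda>p. d + ?g (fst p) + ?g (snd p) + (case p of (a, b) \<Rightarrow> ?r a b))"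
      by (simp add: D_def case_prod_unfold)
    also have "\<dots> = d + (measure_pmf.expectation ?A ?g + measure_pmf.expectation ?B ?g) + R"
      by (simp add: Bochner_Integration.integral_add int R_def)
    also have "measure_pmf.expectation ?A ?g + measure_pmf.expectation ?B ?g =
        (real (num_degree G k) - real (num_degree G (Suc k))) / real n"
      unfolding expectation_parents_sum[OF q n G] sum_gain[OF well_formed_finite_verts[OF G]] ..
    \<comment> \<open>By the stationarity equation \<open>d\<close> is exactly the correction that
      replaces both counts by their centred versions.\<close>
    also have "d + \<dots> = (Y - X) / real n"
    proof -
      have d: "d = center (Suc k) - center k"
        using center_Suc[of k] by (simp add: d_def)
      show ?thesis
        unfolding d using n by (simp add: X_def Y_def deviation_def field_simps)
    qed
    finally show ?thesis .
  qed
  have "measure_pmf.expectation (step_pmf q (Suc n) G) (\<lambda>H. (deviation (Suc n) (Suc k) H)\<^sup>2)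
      = measure_pmf.expectation ?P (\<lambda>p. (X + D p)\<^sup>2)"
    unfolding step_pmf_eq_map_pair integral_map_pmf
    by (intro integral_cong_AE) (auto simp: AE_measure_pmf_iff dev simp del: set_pair_pmf)
  also have "\<dots> \<le> measure_pmf.expectation ?P (\<lambda>p. X\<^sup>2 + 2 * X * D p + 49)"
    using D_sq by (intro integral_mono int) (simp add: power2_sum)
  also have "\<dots> = X\<^sup>2 + 2 * X * measure_pmf.expectation ?P D + 49"
    by (simp add: Bochner_Integration.integral_add int)
  also have "\<dots> = X\<^sup>2 + (2 * X * Y - 2 * X\<^sup>2) / real n + 2 * (X * R) + 49"
    unfolding drift by (simp add: field_simps power2_eq_square)
  \<comment> \<open>The cross term is split by \<open>2 * X * Y \<le> X\<^sup>2 + Y\<^sup>2\<close>.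
    The error \<open>R\<close> is at most \<open>2 / n\<close> while \<open>X\<close> is at most
    \<open>2 * n\<close>, whence 4 and the final constant 57 = 8 + 49.\<close>
  also have "\<dots> \<le> X\<^sup>2 + (Y\<^sup>2 - X\<^sup>2) / real n + 2 * 4 + 49"
  proof -
    have "(2 * X * Y - 2 * X\<^sup>2) / real n \<le> (Y\<^sup>2 - X\<^sup>2) / real n"
      using sum_squares_bound[of X Y] by (intro divide_right_mono) simp_all
    moreover have "X * R \<le> 4"
    proof -
      have "X * R \<le> \<bar>X\<bar> * \<bar>R\<bar>"
        by (simp add: abs_mult[symmetric])
      also have "\<dots> \<le> (2 * real n) * (2 / real n)"
        unfolding X_def by (intro mult_mono abs_deviation_le[OF G] R) auto
      also have "\<dots> = 4"
        using n by simp
      finally show ?thesis .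
    qed
    ultimately show ?thesis
      by linarith
  qed
  also have "\<dots> = (1 - 1 / real n) * X\<^sup>2 + Y\<^sup>2 / real n + 57"
    using n by (simp add: field_simps)
  finally show ?thesis
    by (simp add: X_def Y_def)
qed

end

subsection \<open>The law of the tree\<close>

text \<open>The index is shifted: \<open>tree_law q m\<close> is the law of the tree with time-labels \<open>1, \<dots>, m + 1\<close>.\<close>

primrec tree_law :: "real \<Rightarrow> nat \<Rightarrow> node ugraph pmf" where
  "tree_law q 0 = return_pmf root_tree"
| "tree_law q (Suc m) = bind_pmf (tree_law q m) (step_pmf q (Suc (Suc m)))"

lemma tree_law_support:
  assumes "0 \<le> q" "q \<le> 1"
  shows "finite (set_pmf (tree_law q m)) \<and> (\<forall>G\<in>set_pmf (tree_law q m). well_formed (Suc m) G)"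
proof (induction m)
  case 0
  then show ?case
    using well_formed_root_tree by simp
next
  case (Suc m)
  then show ?case
    using finite_set_step_pmf[OF assms, of "Suc m"] well_formed_step_pmf[OF assms, of "Suc m"]
    by (auto simp: set_bind_pmf)
qed

text \<open>Linear growth is far below the trivial quadratic bound, which is what concentration
  needs. The constant depends on \<open>k\<close> only through the induction, never on
  \<open>m\<close>.\<close>

lemma second_moment_bound:
  assumes q: "0 \<le> q" "q \<le> 1"
  shows "\<exists>C\<ge>0. \<forall>m. measure_pmf.expectation (tree_law q m) (\<lambda>G. (deviation (Suc m) k G)\<^sup>2)
    \<le> C * real (Suc m)"
proof (induction k)
  case 0
  have "measure_pmf.expectation (tree_law q m) (\<lambda>G. (deviation (Suc m) 0 G)\<^sup>2) =
      measure_pmf.expectation (tree_law q m) (\<lambda>G. 0)" for m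
    using tree_law_support[OF q, of m]
    by (intro integral_cong_AE) (auto simp: AE_measure_pmf_iff deviation_def center_def num_degree_0)
  then show ?case
    by (intro exI[of _ 0]) simp
next
  case (Suc k)
  let ?E = "\<lambda>k m. measure_pmf.expectation (tree_law q m) (\<lambda>G. (deviation (Suc m) k G)\<^sup>2)"
  from Suc obtain C where C: "C \<ge> 0" "\<And>m. ?E k m \<le> C * real (Suc m)"
    by blast
  \<comment> \<open>Chosen so that the loss \<open>D\<close> caused by the factor
    \<open>1 - 1 / n\<close> on \<open>D * n\<close> exactly absorbs the input
    \<open>C + 57\<close>.\<close>
  define D where "D = C + 57"
  have "?E (Suc k) m \<le> D * real (Suc m)" for m
  proof (induction m)
    case 0
    have "\<bar>deviation 1 (Suc k) root_tree\<bar> \<le> 2"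
      using abs_deviation_le[OF well_formed_root_tree, of "Suc k"] by simp
    then have "(deviation 1 (Suc k) root_tree)\<^sup>2 \<le> 2\<^sup>2"
      by (metis abs_le_square_iff abs_numeral)
    then show ?case
      using C(1) by (simp add: D_def)
  next
    case (Suc m)
    let ?n = "Suc m"
    note supp = tree_law_support[OF q, of m]
    note int = integrable_measure_pmf_finite[OF conjunct1[OF supp]]
    have "?E (Suc k) (Suc m) = measure_pmf.expectation (tree_law q m) (\<lambda>G.
        measure_pmf.expectation (step_pmf q (Suc ?n) G) (\<lambda>H. (deviation (Suc ?n) (Suc k) H)\<^sup>2))"
      unfolding tree_law.simps
      using supp by (intro expectation_bind_pmf_finite) (auto intro: finite_set_step_pmf[OF q, of ?n])
    also have "\<dots> \<le> measure_pmf.expectation (tree_law q m) (\<lambda>G.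
        (1 - 1 / real ?n) * (deviation ?n (Suc k) G)\<^sup>2 + (deviation ?n k G)\<^sup>2 / real ?n + 57)"
      using supp by (intro integral_mono_AE int)
        (auto simp: AE_measure_pmf_iff intro!: expectation_step_deviation_sq[OF q] simp del: of_nat_Suc)
    also have "\<dots> = (1 - 1 / real ?n) * ?E (Suc k) m + ?E k m / real ?n + 57"
      by (simp add: Bochner_Integration.integral_add int del: of_nat_Suc)
    also have "\<dots> \<le> (1 - 1 / real ?n) * (D * real ?n) + (C * real ?n) / real ?n + 57"
      using Suc C(2)[of m] by (intro add_mono mult_left_mono divide_right_mono) auto
    also have "\<dots> = D * real ?n"
      by (simp add: D_def field_simps del: of_nat_Suc)
    also have "\<dots> \<le> D * real (Suc ?n)"
      using C(1) by (intro mult_left_mono) (auto simp: D_def)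
    finally show ?case .
  qed
  then show ?case
    using C(1) by (intro exI[of _ D]) (simp add: D_def)
qed

subsection \<open>Identifying the law of the process\<close>

text \<open>
  A history lists the trees up to the current one, newest first. Its support is finite, so the
  law of the whole history determines that of the current tree by finite summation.
\<close>

primrec history_law :: "real \<Rightarrow> nat \<Rightarrow> node ugraph list pmf" where
  "history_law q 0 = return_pmf [root_tree]"
| "history_law q (Suc m) =
     bind_pmf (history_law q m) (\<lambda>l. map_pmf (\<lambda>G. G # l) (step_pmf q (Suc (Suc m)) (hd l)))"

lemma tree_law_eq_map_history: "tree_law q m = map_pmf hd (history_law q m)"
  by (induction m) (simp_all add: map_bind_pmf bind_map_pmf map_pmf_comp)

lemma finite_history_law:
  assumes "0 \<le> q" "q \<le> 1"
  shows "finite (set_pmf (history_law q m))"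
proof (induction m)
  case (Suc m)
  have "well_formed (Suc m) (hd l)" if "l \<in> set_pmf (history_law q m)" for l
    using that tree_law_support[OF assms, of m] by (simp add: tree_law_eq_map_history)
  then show ?case
    using Suc finite_set_step_pmf[OF assms, of "Suc m"] by (auto simp: set_bind_pmf)
qed simp

text \<open>The list \<open>G # l\<close> determines its tail, so a single term of the mixture
  survives. The result has the same product form as \<open>transition\<close>.\<close>

lemma pmf_history_law_Suc:
  "pmf (history_law q (Suc m)) (G # l) = pmf (history_law q m) l * pmf (step_pmf q (Suc (Suc m)) (hd l)) G"
proof -
  have "pmf (map_pmf (\<lambda>G. G # l') (step_pmf q (Suc (Suc m)) (hd l'))) (G # l) =
      indicator {l} l' * pmf (step_pmf q (Suc (Suc m)) (hd l)) G" for l'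
  proof (cases "l' = l")
    case True
    then show ?thesis
      using pmf_map_inj'[of "\<lambda>G. G # l"] by (simp add: inj_def)
  next
    case False
    then show ?thesis
      by (auto simp: pmf_eq_0_set_pmf)
  qed
  then show ?thesis
    by (simp add: pmf_bind measure_pmf_single)
qed

primrec trajectory :: "(nat \<Rightarrow> 'w \<Rightarrow> 'a) \<Rightarrow> nat \<Rightarrow> 'w \<Rightarrow> 'a list" where
  "trajectory T 0 \<omega> = [T 1 \<omega>]"
| "trajectory T (Suc m) \<omega> = T (Suc (Suc m)) \<omega> # trajectory T m \<omega>"

lemma hd_trajectory [simp]: "hd (trajectory T m \<omega>) = T (Suc m) \<omega>"
  by (cases m) auto

text \<open>Translates between lists, newest first, and the time-indexed functions of
  \<open>transition\<close>: time \<open>i\<close> sits at position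
  \<open>Suc m - i\<close>.\<close>

lemma trajectory_eq_iff:
  "length l = Suc m \<Longrightarrow> trajectory T m \<omega> = l \<longleftrightarrow> (\<forall>i\<in>{1..Suc m}. T i \<omega> = l ! (Suc m - i))"
proof (induction m arbitrary: l)
  case 0
  then show ?case
    by (auto simp: length_Suc_conv)
next
  case (Suc m)
  then obtain G l' where l: "l = G # l'" "length l' = Suc m"
    by (auto simp: length_Suc_conv)
  have "(\<forall>i\<in>{1..Suc m}. T i \<omega> = l ! (Suc (Suc m) - i)) \<longleftrightarrow>
      (\<forall>i\<in>{1..Suc m}. T i \<omega> = l' ! (Suc m - i))"
    by (intro ball_cong) (auto simp: l Suc_diff_le)
  moreover have "{1..Suc (Suc m)} = insert (Suc (Suc m)) {1..Suc m}"
    by auto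
  ultimately show ?case
    using Suc.IH[OF l(2)] by (simp add: l(1))
qed

section \<open>Transfer to an arbitrary realisation of the process\<close>

context BCMRT
begin

lemma sets_trajectory: "{\<omega> \<in> space M. trajectory T m \<omega> = l} \<in> events"
proof (induction m arbitrary: l)
  have T: "{\<omega> \<in> space M. T (Suc n) \<omega> = G} \<in> events" for n G
    using measurable_sets[OF measurable_T[of "Suc n"], of "{G}"] by (simp add: vimage_def Int_def conj_commute)
  {
    case 0
    have "{\<omega> \<in> space M. trajectory T 0 \<omega> = l} = (if \<exists>G. l = [G] then {\<omega> \<in> space M. T (Suc 0) \<omega> = hd l} else {})"
      by auto
    then show ?case using T by simp
  next
    case (Suc m)
    show ?case
    proof (cases l)
      case (Cons G l')
      then have "{\<omega> \<in> space M. trajectory T (Suc m) \<omega> = l} =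
          {\<omega> \<in> space M. T (Suc (Suc m)) \<omega> = G} \<inter> {\<omega> \<in> space M. trajectory T m \<omega> = l'}"
        by auto
      then show ?thesis using T Suc by auto
    qed simp
  }
qed

lemma prob_trajectory_Suc:
  assumes "length l = Suc m"
  shows "prob {\<omega> \<in> space M. trajectory T (Suc m) \<omega> = G # l} =
    prob {\<omega> \<in> space M. trajectory T m \<omega> = l} * pmf (step_pmf q (Suc (Suc m)) (hd l)) G"
proof -
  \<comment> \<open>Reads the list backwards in time. Only times from 1 to \<open>m + 2\<close> are
    evaluated; at 0 the position would be out of range.\<close>
  define h where "h i = (G # l) ! (Suc (Suc m) - i)" for i
  have "trajectory T (Suc m) \<omega> = G # l \<longleftrightarrow> (\<forall>i\<in>{1..Suc m + 1}. T i \<omega> = h i)" for \<omega>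
    using trajectory_eq_iff[of "G # l" "Suc m" T \<omega>] assms by (simp add: h_def)
  moreover have "trajectory T m \<omega> = l \<longleftrightarrow> (\<forall>i\<in>{1..Suc m}. T i \<omega> = h i)" for \<omega>
    unfolding trajectory_eq_iff[OF assms]
    by (intro ball_cong) (auto simp: h_def Suc_diff_le)
  moreover have "h (Suc m) = hd l" "h (Suc m + 1) = G"
    using assms by (auto simp: h_def length_Suc_conv)
  ultimately show ?thesis
    using transition[of "Suc m" h] by simp
qed

lemma length_history_law: "l \<in> set_pmf (history_law q m) \<Longrightarrow> length l = Suc m"
  by (induction m arbitrary: l) (auto simp: set_bind_pmf)

text \<open>Both sides start at 1 and are multiplied by the same transition probability at each
  step.\<close>

lemma prob_trajectory:
  "l \<in> set_pmf (history_law q m) \<Longrightarrow>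
    prob {\<omega> \<in> space M. trajectory T m \<omega> = l} = pmf (history_law q m) l"
proof (induction m arbitrary: l)
  case 0
  have "AE \<omega> in M. trajectory T 0 \<omega> = [root_tree]"
    using initial by simp
  then show ?case
    using 0 sets_trajectory[of 0 "[root_tree]"] by (simp add: prob_Collect_eq_1)
next
  case (Suc m)
  from Suc.prems obtain G l' where l: "l = G # l'" "l' \<in> set_pmf (history_law q m)"
    by (auto simp: set_bind_pmf)
  then show ?case
    using Suc.IH[OF l(2)] prob_trajectory_Suc[of l' m G] length_history_law[OF l(2)]
    by (simp only: pmf_history_law_Suc)
qed

text \<open>Summing over the finitely many histories in the support only gives a lower bound, since
  other paths are not excluded beforehand. Applying it to the complementary event as well forces
  equality.\<close>

lemma prob_T:
  assumes q: "0 \<le> q" "q \<le> 1"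
  shows "prob {\<omega> \<in> space M. P (T (Suc m) \<omega>)} = measure_pmf.prob (tree_law q m) {G. P G}"
proof -
  have sets: "{\<omega> \<in> space M. P (T (Suc m) \<omega>)} \<in> events" for P
    using measurable_sets[OF measurable_T[of "Suc m"], of "Collect P"]
    by (simp add: vimage_def Int_def conj_commute)
  have lower: "measure_pmf.prob (tree_law q m) {G. P G} \<le> prob {\<omega> \<in> space M. P (T (Suc m) \<omega>)}" for P
  proof -
    define S where "S = {l \<in> set_pmf (history_law q m). P (hd l)}"
    have fin: "finite S"
      using finite_history_law[OF q] by (simp add: S_def)
    have "measure_pmf.prob (tree_law q m) {G. P G} = measure_pmf.prob (history_law q m) {l. P (hd l)}"
      by (simp add: tree_law_eq_map_history vimage_def)
    also have "\<dots> = measure_pmf.prob (history_law q m) S"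
      by (intro measure_pmf.finite_measure_eq_AE) (auto simp: AE_measure_pmf_iff S_def)
    also have "\<dots> = (\<Sum>l\<in>S. prob {\<omega> \<in> space M. trajectory T m \<omega> = l})"
      using fin by (simp add: measure_measure_pmf_finite prob_trajectory S_def)
    also have "\<dots> = prob (\<Union>l\<in>S. {\<omega> \<in> space M. trajectory T m \<omega> = l})"
      using fin sets_trajectory
      by (intro finite_measure_finite_Union[symmetric]) (auto simp: disjoint_family_on_def)
    also have "\<dots> \<le> prob {\<omega> \<in> space M. P (T (Suc m) \<omega>)}"
      by (intro finite_measure_mono sets) (auto simp: S_def hd_trajectory[symmetric] simp del: hd_trajectory)
    finally show ?thesis .
  qed
  have "prob {\<omega> \<in> space M. \<not> P (T (Suc m) \<omega>)} = 1 - prob {\<omega> \<in> space M. P (T (Suc m) \<omega>)}"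
    using sets by (rule prob_neg)
  moreover have "measure_pmf.prob (tree_law q m) {G. \<not> P G} = 1 - measure_pmf.prob (tree_law q m) {G. P G}"
    using measure_pmf.prob_neg[of "tree_law q m" P] by simp
  ultimately show ?thesis
    using lower[of P] lower[of "\<lambda>G. \<not> P G"] by simp
qed

end

section \<open>Convergence in probability by Chebyshev's inequality\<close>

theorem theorem1:
  fixes M :: "'w measure" and q :: real and T :: "nat \<Rightarrow> 'w \<Rightarrow> node ugraph" and k :: nat
  assumes "0 \<le> q" and "q \<le> 1"
    and "BCMRT M q T"
    and "k \<ge> 1"
  shows "tendsto_in_probability M
    (\<lambda>n \<omega>. real (num_degree (T n \<omega>) k) / (2 * real n)) (\<lambda>_. 1 / 2 ^ k)"
  unfolding tendsto_in_probability_def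
proof (intro allI impI)
  fix \<epsilon> :: real
  assume \<epsilon>: "\<epsilon> > 0"
  interpret BCMRT M q T by fact
  note q = assms(1,2)
  let ?far = "\<lambda>n G. \<bar>real (num_degree G k) / (2 * real n) - 1 / 2 ^ k\<bar> > \<epsilon>"
  obtain C where C: "C \<ge> 0" "\<And>m. measure_pmf.expectation (tree_law q m)
      (\<lambda>G. (deviation (Suc m) k G)\<^sup>2) \<le> C * real (Suc m)"
    using second_moment_bound[OF q, of k] by blast
  \<comment> \<open>Markov's inequality for the squared deviation: a second moment of at most
    \<open>C * n\<close> against the squared threshold
    \<open>(2 * n * \<epsilon>)\<^sup>2\<close>.\<close>
  have bound: "prob {\<omega> \<in> space M. ?far (Suc m) (T (Suc m) \<omega>)} \<le> C / (4 * \<epsilon>\<^sup>2) / real (Suc m)" for m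
  proof -
    let ?n = "real (Suc m)"
    have npos: "?n > 0"
      by simp
    let ?c = "(2 * ?n * \<epsilon>)\<^sup>2"
    note int = integrable_measure_pmf_finite[OF conjunct1[OF tree_law_support[OF q, of m]]]
    have far: "?c \<le> (deviation (Suc m) k G)\<^sup>2" if "?far (Suc m) G" for G
    proof -
      \<comment> \<open>For \<open>k \<ge> 1\<close> half of \<open>center k\<close> is the claimed
        limit; at \<open>k = 0\<close> the exceptional value would break this.\<close>
      have "real (num_degree G k) / (2 * ?n) - 1 / 2 ^ k = deviation (Suc m) k G / (2 * ?n)"
        using assms(4) npos by (simp add: deviation_def center_def diff_divide_distrib del: of_nat_Suc)
      with that have "\<epsilon> < \<bar>deviation (Suc m) k G\<bar> / (2 * ?n)"
        using npos by (simp add: abs_divide del: of_nat_Suc)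
      then have "2 * ?n * \<epsilon> \<le> \<bar>deviation (Suc m) k G\<bar>"
        using npos by (simp add: field_simps del: of_nat_Suc)
      then have "?c \<le> \<bar>deviation (Suc m) k G\<bar>\<^sup>2"
        using \<epsilon> by (intro power_mono) auto
      then show ?thesis by simp
    qed
    have "prob {\<omega> \<in> space M. ?far (Suc m) (T (Suc m) \<omega>)} =
        measure_pmf.prob (tree_law q m) {G. ?far (Suc m) G}"
      by (rule prob_T[OF q])
    also have "\<dots> \<le> measure_pmf.prob (tree_law q m) {G. ?c \<le> (deviation (Suc m) k G)\<^sup>2}"
      using far by (intro measure_pmf.finite_measure_mono) auto
    also have "\<dots> \<le> measure_pmf.expectation (tree_law q m) (\<lambda>G. (deviation (Suc m) k G)\<^sup>2) / ?c"
      using integral_Markov_inequality_measure[OF int, of "{}" "\<lambda>G. (deviation (Suc m) k G)\<^sup>2" ?c] \<epsilon> npos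
      by (simp del: of_nat_Suc)
    also have "\<dots> \<le> C * ?n / ?c"
      by (intro divide_right_mono C(2)) simp
    also have "\<dots> = C / (4 * \<epsilon>\<^sup>2) / ?n"
      using npos by (simp add: power2_eq_square field_simps del: of_nat_Suc)
    finally show ?thesis .
  qed
  have "(\<lambda>m. C / (4 * \<epsilon>\<^sup>2) / real (Suc m)) \<longlonglongrightarrow> 0"
    by (rule LIMSEQ_Suc[OF lim_const_over_n])
  then have "(\<lambda>m. prob {\<omega> \<in> space M. ?far (Suc m) (T (Suc m) \<omega>)}) \<longlonglongrightarrow> 0"
    by (rule tendsto_sandwich[rotated 3, where f = "\<lambda>_. 0"]) (use bound in \<open>auto simp del: of_nat_Suc\<close>)
  \<comment> \<open>The bound was proved along \<open>Suc m\<close>; the shift of index does not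
    affect the limit.\<close>
  then show "(\<lambda>n. prob {\<omega> \<in> space M. ?far n (T n \<omega>)}) \<longlonglongrightarrow> 0"
    by (rule LIMSEQ_imp_Suc)
qed

end
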